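(* Let $(X,q)$ be an affine mobi space over a mobi algebra $(A,p,0,\tfrac12,1)$, and let $e\in X$ be a fixed chosen element. If $A$ contains an element $2$ such that $p(0,\tfrac12,2)=1$, then $(X,+,e,\varphi)$ is a module over the unitary ring $(A,+,\cdot,0,1)$, where for $a,b\in A$ and $x,y\in X$ $$a+b=p(0,2,p(a,\tfrac12,b)),\qquad a\cdot b=p(0,a,b),$$ $$\varphi_a(x)=q(e,a,x),\qquad x+y=q(e,2,q(x,\tfrac12,y))=\varphi_2(q(x,\tfrac12,y)).$$
   Context: Rings are unitary and not necessarily commutative. A module over a ring $A$ is a system $(X,+,e,\varphi)$ where $(X,+,e)$ is an abelian group with identity $e$ and $\varphi\colon A\to\mathrm{End}(X)$, $a\mapsto\varphi_a$, is a homomorphism of unitary rings. A mobi algebra is a system $(A,p,0,\tfrac12,1)$ consisting of a set $A$, a ternary operation $p\colon A^3\to A$ and three constants $0,\tfrac12,1\in A$ such that for all elements of $A$: (A1) $p(1,\tfrac12,0)=\tfrac12$; (A2) $p(0,a,1)=a$; (A3) $p(a,b,a)=a$; (A4) $p(a,0,b)=a$; (A5) $p(b,1,a)=a$; (A6) $p(a,\tfrac12,b)=p(a,\tfrac12,c)\Rightarrow b=c$; (A7) $p(a,p(b_1,b_2,b_3),c)=p(p(a,b_1,c),b_2,p(a,b_3,c))$; (A8) $p(p(a_1,b,c_1),\tfrac12,p(a_2,b,c_2))=p(p(a_1,\tfrac12,a_2),b,p(c_1,\tfrac12,c_2))$. A mobi space over a mobi algebra $A$ is a pair $(X,q)$ with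 $X$ a set and $q\colon X\times A\times X\to X$ a map such that for all elements: (X1) $q(x,0,y)=x$; (X2) $q(y,1,x)=x$; (X3) $q(x,a,x)=x$; (X4) $q(x,\tfrac12,y)=q(x,\tfrac12,y')\Rightarrow y=y'$; (X5) $q(q(x,a,y),b,q(x,c,y))=q(x,p(a,b,c),y)$. It is affine if $q(q(x_1,a,y_1),\tfrac12,q(x_2,a,y_2))=q(q(x_1,\tfrac12,x_2),a,q(y_1,\tfrac12,y_2))$ for all $x_1,x_2,y_1,y_2\in X$, $a\in A$. *)

theory Defs
  imports "HOL-Algebra.Ring"
begin

locale mobi_algebra =
  fixes A :: "'a set" and p :: "'a \<Rightarrow> 'a \<Rightarrow> 'a \<Rightarrow> 'a"
    and zero_A half_A one_A :: 'a
  assumes zero_closed: "zero_A \<in> A"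
    and half_closed: "half_A \<in> A"
    and one_closed: "one_A \<in> A"
    and p_closed: "\<lbrakk>a \<in> A; b \<in> A; c \<in> A\<rbrakk> \<Longrightarrow> p a b c \<in> A"
    and A1: "p one_A half_A zero_A = half_A"
    and A2: "a \<in> A \<Longrightarrow> p zero_A a one_A = a"
    and A3: "\<lbrakk>a \<in> A; b \<in> A\<rbrakk> \<Longrightarrow> p a b a = a"
    and A4: "\<lbrakk>a \<in> A; b \<in> A\<rbrakk> \<Longrightarrow> p a zero_A b = a"
    and A5: "\<lbrakk>a \<in> A; b \<in> A\<rbrakk> \<Longrightarrow> p b one_A a = a"
    and A6: "\<lbrakk>a \<in> A; b \<in> A; c \<in> A; p a half_A b = p a half_A c\<rbrakk> \<Longrightarrow> b = c"
    and A7: "\<lbrakk>a \<in> A; b\<^sub>1 \<in> A; b\<^sub>2 \<in> A; b\<^sub>3 \<in> A; c \<in> A\<rbrakk> \<Longrightarrow>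
      p a (p b\<^sub>1 b\<^sub>2 b\<^sub>3) c = p (p a b\<^sub>1 c) b\<^sub>2 (p a b\<^sub>3 c)"
    and A8: "\<lbrakk>a\<^sub>1 \<in> A; a\<^sub>2 \<in> A; b \<in> A; c\<^sub>1 \<in> A; c\<^sub>2 \<in> A\<rbrakk> \<Longrightarrow>
      p (p a\<^sub>1 b c\<^sub>1) half_A (p a\<^sub>2 b c\<^sub>2) = p (p a\<^sub>1 half_A a\<^sub>2) b (p c\<^sub>1 half_A c\<^sub>2)"

locale mobi_space = mobi_algebra A p zero_A half_A one_A
  for A :: "'a set" and p zero_A half_A one_A +
  fixes X :: "'x set" and q :: "'x \<Rightarrow> 'a \<Rightarrow> 'x \<Rightarrow> 'x"
  assumes q_closed: "\<lbrakk>x \<in> X; a \<in> A; y \<in> X\<rbrakk> \<Longrightarrow> q x a y \<in> X"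
    and X1: "\<lbrakk>x \<in> X; y \<in> X\<rbrakk> \<Longrightarrow> q x zero_A y = x"
    and X2: "\<lbrakk>x \<in> X; y \<in> X\<rbrakk> \<Longrightarrow> q y one_A x = x"
    and X3: "\<lbrakk>x \<in> X; a \<in> A\<rbrakk> \<Longrightarrow> q x a x = x"
    and X4: "\<lbrakk>x \<in> X; y \<in> X; y' \<in> X; q x half_A y = q x half_A y'\<rbrakk> \<Longrightarrow> y = y'"
    and X5: "\<lbrakk>x \<in> X; y \<in> X; a \<in> A; b \<in> A; c \<in> A\<rbrakk> \<Longrightarrow>
      q (q x a y) b (q x c y) = q x (p a b c) y"

locale affine_mobi_space = mobi_space +
  assumes affine: "\<lbrakk>x\<^sub>1 \<in> X; x\<^sub>2 \<in> X; y\<^sub>1 \<in> X; y\<^sub>2 \<in> X; a \<in> A\<rbrakk> \<Longrightarrow>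
    q (q x\<^sub>1 a y\<^sub>1) half_A (q x\<^sub>2 a y\<^sub>2) = q (q x\<^sub>1 half_A x\<^sub>2) a (q y\<^sub>1 half_A y\<^sub>2)"

text \<open>
  The library's \<open>module\<close> locale demands a commutative ring of scalars. Here a module is an
  abelian group (a \<open>monoid\<close> record whose \<open>mult\<close> is the group addition) together with
  a unitary ring homomorphism into its endomorphism ring. Endomorphisms are taken extensional,
  as in \<open>BijGroup\<close>, so that functions agreeing on the carrier are equal.
\<close>

definition endo_ring :: "('x, 'm) monoid_scheme \<Rightarrow> ('x \<Rightarrow> 'x) ring" where
  "endo_ring M =
    \<lparr>carrier = hom M M \<inter> extensional (carrier M),
     monoid.mult = (\<lambda>f g. compose (carrier M) f g),
     one = (\<lambda>x \<in> carrier M. x),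
     zero = (\<lambda>x \<in> carrier M. \<one>\<^bsub>M\<^esub>),
     add = (\<lambda>f g. \<lambda>x \<in> carrier M. f x \<otimes>\<^bsub>M\<^esub> g x)\<rparr>"

locale ring_module = R: ring R + M: comm_group M
  for R :: "('a, 'r) ring_scheme" and M :: "('x, 'm) monoid_scheme" +
  fixes \<phi> :: "'a \<Rightarrow> 'x \<Rightarrow> 'x"
  assumes action_hom: "\<phi> \<in> ring_hom R (endo_ring M)"

lemma (in comm_group) endo_ring_is_ring: "ring (endo_ring G)"
proof (rule ringI)
  show "abelian_group (endo_ring G)"
  proof (rule abelian_groupI)
    fix f assume f: "f \<in> carrier (endo_ring G)"
    let ?g = "\<lambda>x \<in> carrier G. inv (f x)"
    have "?g \<in> carrier (endo_ring G)"
      using f by (auto simp: endo_ring_def hom_def Pi_def inv_mult)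
    moreover have "?g \<oplus>\<^bsub>endo_ring G\<^esub> f = \<zero>\<^bsub>endo_ring G\<^esub>"
      using f by (auto simp: endo_ring_def hom_def Pi_def fun_eq_iff)
    ultimately show "\<exists>g \<in> carrier (endo_ring G). g \<oplus>\<^bsub>endo_ring G\<^esub> f = \<zero>\<^bsub>endo_ring G\<^esub>"
      by blast
  qed (auto simp: endo_ring_def hom_def Pi_def fun_eq_iff m_ac extensional_def)
  show "monoid (endo_ring G)"
    by (rule monoidI)
      (auto simp: endo_ring_def hom_def Pi_def compose_def fun_eq_iff extensional_def)
qed (auto simp: endo_ring_def hom_def Pi_def compose_def fun_eq_iff)

definition mobi_ring :: "'a set \<Rightarrow> ('a \<Rightarrow> 'a \<Rightarrow> 'a \<Rightarrow> 'a) \<Rightarrow> 'a \<Rightarrow> 'a \<Rightarrow> 'a \<Rightarrow> 'a \<Rightarrow> 'a ring" where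
  "mobi_ring A p zero_A half_A one_A two_A =
    \<lparr>carrier = A,
     monoid.mult = (\<lambda>a b. p zero_A a b),
     one = one_A,
     zero = zero_A,
     add = (\<lambda>a b. p zero_A two_A (p a half_A b))\<rparr>"

definition mobi_group :: "'x set \<Rightarrow> ('x \<Rightarrow> 'a \<Rightarrow> 'x \<Rightarrow> 'x) \<Rightarrow> 'a \<Rightarrow> 'a \<Rightarrow> 'x \<Rightarrow> 'x monoid" where
  "mobi_group X q half_A two_A e =
    \<lparr>carrier = X,
     monoid.mult = (\<lambda>x y. q e two_A (q x half_A y)),
     one = e\<rparr>"

definition mobi_action :: "'x set \<Rightarrow> ('x \<Rightarrow> 'a \<Rightarrow> 'x \<Rightarrow> 'x) \<Rightarrow> 'x \<Rightarrow> 'a \<Rightarrow> 'x \<Rightarrow> 'x" where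
  "mobi_action X q e a = (\<lambda>x \<in> X. q e a x)"

end

theory Submission
  imports Defs
begin

text \<open>
  Halving \<open>q e \<onehalf>\<close> undoes doubling \<open>q e 2\<close> and is injective, so \<open>x + y\<close> is the unique element
  whose midpoint with \<open>e\<close> is the midpoint of \<open>x\<close> and \<open>y\<close>. By cancellation
  (X4), every identity about \<open>+\<close> thus becomes an identity between midpoints, which follows
  from commutativity, idempotence and mediality of the midpoint operation. The algebra is an
  affine mobi space over itself, so the additive group and the distributive laws of the ring are
  instances of the facts about spaces.
\<close>

locale pointed_affine_mobi_space = affine_mobi_space A p zero_A half_A one_A X q
  for A :: "'a set" and p zero_A half_A one_A and X :: "'x set" and q +
  fixes two_A :: 'a and e :: 'x
  assumes e_closed [simp]: "e \<in> X"
    and two_closed [simp]: "two_A \<in> A"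
    and half_two: "p zero_A half_A two_A = one_A"
begin

declare zero_closed [simp] half_closed [simp] one_closed [simp] p_closed [simp] q_closed [simp]

abbreviation mid :: "'x \<Rightarrow> 'x \<Rightarrow> 'x" where
  "mid x y \<equiv> q x half_A y"

definition plus :: "'x \<Rightarrow> 'x \<Rightarrow> 'x" where
  "plus x y = q e two_A (mid x y)"

lemma plus_closed [simp]: "x \<in> X \<Longrightarrow> y \<in> X \<Longrightarrow> plus x y \<in> X"
  by (simp add: plus_def)

text \<open>By A1 the scalar \<open>half_A\<close> is fixed when 0 and 1 are exchanged; X5 carries
  this exchange to the endpoints \<open>x\<close> and \<open>y\<close>.\<close>

lemma mid_commute:
  assumes "x \<in> X" "y \<in> X"
  shows "mid x y = mid y x"
proof -
  have "mid x y = q x (p one_A half_A zero_A) y"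
    by (simp add: A1)
  also have "\<dots> = mid (q x one_A y) (q x zero_A y)"
    using assms by (simp add: X5)
  finally show ?thesis
    using assms by (simp add: X1 X2)
qed

lemma mid_cancel:
  "\<lbrakk>x \<in> X; y \<in> X; mid e x = mid e y\<rbrakk> \<Longrightarrow> x = y"
  by (rule X4[OF e_closed])

text \<open>This is X5 with \<open>x\<close> written as \<open>q x zero_A y\<close>. The base point
  is left free because inverses need it at \<open>x\<close> rather than at \<open>e\<close>.\<close>

lemma action_action:
  assumes "a \<in> A" "b \<in> A" "x \<in> X" "y \<in> X"
  shows "q x a (q x b y) = q x (p zero_A a b) y"
  using X5[of x y zero_A a b] assms by (simp add: X1)

lemma mid_plus:
  assumes "x \<in> X" "y \<in> X"
  shows "mid e (plus x y) = mid x y"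
  using assms by (simp add: plus_def action_action half_two X2)

lemma plus_unique:
  assumes "x \<in> X" "y \<in> X" "z \<in> X" "mid e z = mid x y"
  shows "plus x y = z"
  using assms by (simp add: mid_cancel mid_plus)

lemma plus_commute: "x \<in> X \<Longrightarrow> y \<in> X \<Longrightarrow> plus x y = plus y x"
  by (simp add: plus_def mid_commute)

lemma plus_left_neutral: "x \<in> X \<Longrightarrow> plus e x = x"
  by (simp add: plus_unique)

lemma plus_assoc:
  assumes "x \<in> X" "y \<in> X" "z \<in> X"
  shows "plus (plus x y) z = plus x (plus y z)"
proof -
  \<comment> \<open>An extra outer halving, with \<open>e\<close> written as \<open>mid e e\<close>,
    gives four entries that the medial law can regroup; it is cancelled at the end.\<close>
  have "mid e (mid e (plus x (plus y z))) = mid (mid e e) (mid x (plus y z))"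
    using assms by (simp add: X3 mid_plus)
  also have "\<dots> = mid (mid e x) (mid e (plus y z))"
    using assms by (intro affine) simp_all
  also have "\<dots> = mid (mid x e) (mid y z)"
    using assms by (simp add: mid_plus mid_commute[of e x])
  also have "\<dots> = mid (mid x y) (mid e z)"
    using assms by (intro affine) simp_all
  also have "\<dots> = mid (mid e (plus x y)) (mid e z)"
    using assms by (simp add: mid_plus)
  also have "\<dots> = mid (mid e e) (mid (plus x y) z)"
    using assms by (intro affine) simp_all
  finally have "mid e (mid e (plus x (plus y z))) = mid e (mid (plus x y) z)"
    by (simp add: X3)
  then have "mid e (plus x (plus y z)) = mid (plus x y) z"
    using assms by (intro mid_cancel[of "mid e (plus x (plus y z))"]) simp_all
  then show ?thesis
    using assms by (intro plus_unique) simp_all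
qed

lemma plus_right_inverse:
  assumes "x \<in> X"
  shows "plus x (q x two_A e) = e"
  \<comment> \<open>The inverse is the reflection of \<open>x\<close> through \<open>e\<close>:
    halfway from \<open>x\<close> to it is scalar 1 on the way from \<open>x\<close> to
    \<open>e\<close>.\<close>
  using assms by (intro plus_unique) (simp_all add: action_action half_two X2 X3)

text \<open>The affine law with both left endpoints equal to \<open>e\<close>, whose midpoint is
  again \<open>e\<close>.\<close>

lemma action_mid:
  assumes "a \<in> A" "x \<in> X" "y \<in> X"
  shows "q e a (mid x y) = mid (q e a x) (q e a y)"
  using affine[of e e x y a] assms by (simp add: X3)

lemma action_plus:
  assumes "a \<in> A" "x \<in> X" "y \<in> X"
  shows "q e a (plus x y) = plus (q e a x) (q e a y)"
proof (rule plus_unique[symmetric])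
  have "mid e (q e a (plus x y)) = q e a (mid e (plus x y))"
    using assms by (simp add: action_mid X3)
  then show "mid e (q e a (plus x y)) = mid (q e a x) (q e a y)"
    using assms by (simp add: mid_plus action_mid)
qed (use assms in simp_all)

lemma comm_group_mobi_group: "comm_group (mobi_group X q half_A two_A e)"
proof (rule comm_groupI)
  fix x assume "x \<in> carrier (mobi_group X q half_A two_A e)"
  then have x: "x \<in> X"
    by (simp add: mobi_group_def)
  then have "plus (q x two_A e) x = e"
    using plus_commute plus_right_inverse by simp
  with x show "\<exists>y\<in>carrier (mobi_group X q half_A two_A e).
      y \<otimes>\<^bsub>mobi_group X q half_A two_A e\<^esub> x = \<one>\<^bsub>mobi_group X q half_A two_A e\<^esub>"
    by (auto simp: mobi_group_def simp flip: plus_def intro!: bexI[of _ "q x two_A e"])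
qed (simp_all add: mobi_group_def plus_assoc plus_left_neutral flip: plus_def, fact plus_commute)

end

lemma (in mobi_algebra) affine_mobi_space_self:
  "affine_mobi_space A p zero_A half_A one_A A p"
  by unfold_locales (simp_all add: p_closed A3 A4 A5 A7 A8, rule A6)

context pointed_affine_mobi_space
begin

text \<open>With base point \<open>zero_A\<close>, \<open>self.plus\<close> is the ring addition and
  the action of \<open>A\<close> on itself is the ring multiplication.\<close>

sublocale self: pointed_affine_mobi_space A p zero_A half_A one_A A p two_A zero_A
  by (intro pointed_affine_mobi_space.intro affine_mobi_space_self
      pointed_affine_mobi_space_axioms.intro zero_closed two_closed half_two)

lemma add_action:
  assumes "a \<in> A" "b \<in> A" "x \<in> X"
  shows "q e (self.plus a b) x = plus (q e a x) (q e b x)"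
proof (rule plus_unique[symmetric])
  \<comment> \<open>The halving merges into the scalar, where it turns the sum into the midpoint of
    \<open>a\<close> and \<open>b\<close>; X5 can then split it.\<close>
  have "mid e (q e (self.plus a b) x) = q e (p a half_A b) x"
    using assms by (simp add: action_action self.mid_plus)
  then show "mid e (q e (self.plus a b) x) = mid (q e a x) (q e b x)"
    using assms by (simp add: X5)
qed (use assms in simp_all)

end

context pointed_affine_mobi_space
begin

abbreviation "R \<equiv> mobi_ring A p zero_A half_A one_A two_A"
abbreviation "M \<equiv> mobi_group X q half_A two_A e"

lemma ring_mobi_ring: "ring R"
proof (rule ringI)
  have "comm_group (add_monoid R)"
    using self.comm_group_mobi_group by (simp add: mobi_ring_def mobi_group_def)
  then show "abelian_group R"
    by (simp add: abelian_group_def abelian_monoid_def abelian_group_axioms_def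
        comm_group.axioms)
  show "monoid R"
    by (rule monoidI) (simp_all add: mobi_ring_def A2 A5 self.action_action)
\<comment> \<open>Additivity of the action in the point and in the scalar are the two distributive
  laws.\<close>
qed (simp_all add: mobi_ring_def self.action_plus self.add_action flip: self.plus_def)

lemma mobi_action_hom: "mobi_action X q e \<in> ring_hom R (endo_ring M)"
  by (rule ring_hom_memI)
    (auto simp: mobi_ring_def mobi_group_def mobi_action_def endo_ring_def hom_def
      compose_def fun_eq_iff action_plus add_action action_action X2
      simp flip: plus_def self.plus_def)

lemma ring_module_mobi: "ring_module R M (mobi_action X q e)"
  by (intro ring_module.intro ring_module_axioms.intro ring_mobi_ring
      comm_group_mobi_group mobi_action_hom)

end

theorem theorem5p2:
  fixes A :: "'a set" and p :: "'a \<Rightarrow> 'a \<Rightarrow> 'a \<Rightarrow> 'a"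
    and zero_A half_A one_A two_A :: 'a
    and X :: "'x set" and q :: "'x \<Rightarrow> 'a \<Rightarrow> 'x \<Rightarrow> 'x" and e :: 'x
  assumes "affine_mobi_space A p zero_A half_A one_A X q"
    and "e \<in> X"
    and "two_A \<in> A"
    and "p zero_A half_A two_A = one_A"
  shows "ring_module (mobi_ring A p zero_A half_A one_A two_A)
           (mobi_group X q half_A two_A e) (mobi_action X q e)
         \<and> (\<forall>x\<in>X. \<forall>y\<in>X. x \<otimes>\<^bsub>mobi_group X q half_A two_A e\<^esub> y
              = mobi_action X q e two_A (q x half_A y))"
proof -
  interpret pointed_affine_mobi_space A p zero_A half_A one_A X q two_A e
    using assms by (intro pointed_affine_mobi_space.intro pointed_affine_mobi_space_axioms.intro)
  show ?thesis
    using ring_module_mobi by (simp add: mobi_group_def mobi_action_def)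
qed

end
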